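(* Let $\Omega\subseteq\mathbb{R}^{n_x}\times\mathbb{R}$ be the projection onto $(\alpha,\beta)$ of the set of all $(y_1,y_2,U,\alpha,\beta)$ with $y_1\in\{0,1\}^{n_{y_1}}$, $y_2\in\mathbb{R}^{n_{y_2}}$, $U\in\mathbb{R}^{n_{y_2}\times n_x}$, $\alpha\in\mathbb{R}^{n_x}$, $\beta\in\mathbb{R}$ satisfying $$\beta\le d_{l1}^\top y_1+d_{l2}^\top y_2+\mathbf 1^\top(U^\top d_{l2}-\alpha)^-,\qquad B_{l1}y_1+B_{l2}y_2\le h_\ell-(A_\ell+B_{l2}U)^+\mathbf 1.$$ Then for any $(\hat\alpha,\hat\beta)\in\Omega$, the inequality $$d_\ell^\top y\ge\hat\alpha^\top x+\hat\beta$$ is valid for $d_\ell^\top y\ge\phi(x)$, i.e. $\hat\alpha^\top x+\hat\beta\le\phi(x)$ for all $x\in\{0,1\}^{n_x}$.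
   Context: The lower-level variable is $y=(y_1,y_2)$ with $y_1\in\{0,1\}^{n_{y_1}}$, $y_2\in\mathbb{R}^{n_{y_2}}$, $d_\ell=(d_{l1},d_{l2})$, and for $x\in\{0,1\}^{n_x}$ $$\phi(x)=\max\{d_{l1}^\top y_1+d_{l2}^\top y_2 : y_1\in\{0,1\}^{n_{y_1}},\ y_2\in\mathbb{R}^{n_{y_2}},\ B_{l1}y_1+B_{l2}y_2\le h_\ell-A_\ell x\},$$ with real data $A_\ell,B_{l1},B_{l2},h_\ell,d_{l1},d_{l2}$ of compatible dimensions. Standing assumption: for every $x\in\{0,1\}^{n_x}$ this lower-level problem is feasible and bounded. $a^+=\max\{a,0\}$ and $a^-=\min\{a,0\}$, applied entrywise to vectors and matrices; $\mathbf 1$ is the all-ones vector. *)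

theory Defs
  imports "HOL-Analysis.Analysis"
begin

definition binary_vectors :: "(real ^ 'n) set" where
  "binary_vectors = {v. \<forall>i. v $ i \<in> {0, 1}}"

definition vec_pos :: "real ^ 'n \<Rightarrow> real ^ 'n" where
  "vec_pos v = (\<chi> i. max (v $ i) 0)"

definition mat_pos :: "real ^ 'n ^ 'm \<Rightarrow> real ^ 'n ^ 'm" where
  "mat_pos M = (\<chi> i. vec_pos (M $ i))"

text \<open>The negative part is \<open>min a 0\<close>, which is nonpositive; it is not \<open>max (- a) 0\<close>.\<close>

definition vec_neg :: "real ^ 'n \<Rightarrow> real ^ 'n" where
  "vec_neg v = (\<chi> i. min (v $ i) 0)"

text \<open>
  Below, \<open>\<le>\<close> on \<open>real ^ 'm\<close> is the componentwise order of the library.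
\<close>

definition lower_feasible ::
  "real ^ 'nx ^ 'm \<Rightarrow> real ^ 'n1 ^ 'm \<Rightarrow> real ^ 'n2 ^ 'm \<Rightarrow> real ^ 'm \<Rightarrow> real ^ 'nx
    \<Rightarrow> ((real ^ 'n1) \<times> (real ^ 'n2)) set" where
  "lower_feasible A B1 B2 h x =
    {(y1, y2). y1 \<in> binary_vectors \<and> B1 *v y1 + B2 *v y2 \<le> h - A *v x}"

definition lower_values ::
  "real ^ 'nx ^ 'm \<Rightarrow> real ^ 'n1 ^ 'm \<Rightarrow> real ^ 'n2 ^ 'm \<Rightarrow> real ^ 'm
    \<Rightarrow> real ^ 'n1 \<Rightarrow> real ^ 'n2 \<Rightarrow> real ^ 'nx \<Rightarrow> real set" where
  "lower_values A B1 B2 h d1 d2 x =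
    (\<lambda>(y1, y2). d1 \<bullet> y1 + d2 \<bullet> y2) ` lower_feasible A B1 B2 h x"

text \<open>
  The value function is a genuine maximum. It is meaningful when the problem is feasible and
  bounded: there are finitely many choices of \<open>y1\<close>, and each remaining linear program
  that is feasible attains its optimum. The library's \<open>Max\<close> is only for finite sets,
  hence \<open>Greatest\<close>.
\<close>

definition phi ::
  "real ^ 'nx ^ 'm \<Rightarrow> real ^ 'n1 ^ 'm \<Rightarrow> real ^ 'n2 ^ 'm \<Rightarrow> real ^ 'm
    \<Rightarrow> real ^ 'n1 \<Rightarrow> real ^ 'n2 \<Rightarrow> real ^ 'nx \<Rightarrow> real" where
  "phi A B1 B2 h d1 d2 x = (GREATEST v. v \<in> lower_values A B1 B2 h d1 d2 x)"

text \<open>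
  Here \<open>1 :: real ^ 'nx\<close> is the all-ones vector.
\<close>

definition Omega ::
  "real ^ 'nx ^ 'm \<Rightarrow> real ^ 'n1 ^ 'm \<Rightarrow> real ^ 'n2 ^ 'm \<Rightarrow> real ^ 'm
    \<Rightarrow> real ^ 'n1 \<Rightarrow> real ^ 'n2 \<Rightarrow> ((real ^ 'nx) \<times> real) set" where
  "Omega A B1 B2 h d1 d2 =
    {(\<alpha>, \<beta>). \<exists>y1 y2. \<exists>U :: real ^ 'nx ^ 'n2.
       y1 \<in> binary_vectors \<and>
       \<beta> \<le> d1 \<bullet> y1 + d2 \<bullet> y2 + 1 \<bullet> vec_neg (transpose U *v d2 - \<alpha>) \<and>
       B1 *v y1 + B2 *v y2 \<le> h - mat_pos (A + B2 ** U) *v 1}"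

end

theory Submission
  imports Defs
begin

text \<open>
  If \<open>(y1, y2, U)\<close> witnesses \<open>(\<alpha>, \<beta>) \<in> \<Omega>\<close>, then the affine decision rule
  \<open>x \<mapsto> (y1, y2 + U x)\<close> is feasible for every binary \<open>x\<close>, because \<open>M x \<le> M\<^sup>+ 1\<close> on the unit
  cube, and its value is at least \<open>\<alpha> \<bullet> x + \<beta>\<close>, because \<open>v \<bullet> x \<ge> 1 \<bullet> v\<^sup>-\<close> there.
  What remains is that the maximum defining \<open>\<phi>\<close> is attained. For a linear program one pushes a
  feasible point along the component of the objective orthogonal to the tight constraints until
  a new constraint becomes tight. This ends at a point where the objective lies in the span of the
  tight constraints; the value there depends only on the set of tight constraints, so only
  finitely many such values exist.
\<close>

section \<open>Attainment of the maximum in a bounded linear program\<close>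

lemma linear_program_tight_point:
  fixes a :: "'i \<Rightarrow> 'v::euclidean_space" and b :: "'i \<Rightarrow> real"
  assumes "finite I"
    and bounded: "\<And>y. \<forall>i\<in>I. a i \<bullet> y \<le> b i \<Longrightarrow> d \<bullet> y \<le> M"
    and "\<forall>i\<in>I. a i \<bullet> y \<le> b i"
  shows "\<exists>y'. (\<forall>i\<in>I. a i \<bullet> y' \<le> b i) \<and> d \<bullet> y \<le> d \<bullet> y' \<and>
    d \<in> span (a ` {i\<in>I. a i \<bullet> y' = b i})"
  using assms(3)
\<comment> \<open>The measure counts the slack constraints; each push lowers it.\<close>
proof (induction "card {i\<in>I. a i \<bullet> y \<noteq> b i}" arbitrary: y rule: less_induct)
  case less
  let ?T = "\<lambda>y. {i\<in>I. a i \<bullet> y = b i}"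
  show ?case
  proof (cases "d \<in> span (a ` ?T y)")
    case True
    then show ?thesis
      by (intro exI[of _ y] conjI less.prems order_refl)
  next
    case False
    obtain s z where s: "s \<in> span (a ` ?T y)"
      and z: "\<And>w. w \<in> span (a ` ?T y) \<Longrightarrow> orthogonal z w" and d: "d = s + z"
      using orthogonal_subspace_decomp_exists[of "a ` ?T y" d] by blast
    have "z \<noteq> 0"
      using False s d by auto
    moreover have "d \<bullet> z = z \<bullet> z"
      using z[OF s] d by (simp add: orthogonal_def inner_add_left inner_commute[of s z])
    ultimately have dz: "d \<bullet> z > 0"
      by simp
    have az: "a i \<bullet> z = 0" if "i \<in> ?T y" for i
      using z[OF span_base[of "a i"]] that by (auto simp: orthogonal_def inner_commute)
    define J where "J = {i\<in>I. a i \<bullet> z > 0}"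
    have "finite J"
      using assms(1) by (simp add: J_def)
    \<comment> \<open>Otherwise no constraint grows along \<open>z\<close>, so the whole ray from
      \<open>y\<close> is feasible; the \<open>t\<close> chosen below lifts the objective to at
      least \<open>M + 1\<close>.\<close>
    have "J \<noteq> {}"
    proof
      assume "J = {}"
      define t where "t = (\<bar>M - d \<bullet> y\<bar> + 1) / (d \<bullet> z)"
      have "t \<ge> 0"
        using dz by (simp add: t_def)
      have "a i \<bullet> (y + t *\<^sub>R z) \<le> b i" if "i \<in> I" for i
      proof -
        have "t * (a i \<bullet> z) \<le> 0"
          using \<open>J = {}\<close> that \<open>t \<ge> 0\<close> by (auto simp: J_def not_less intro: mult_nonneg_nonpos)
        then show ?thesis
          using less.prems that by (force simp: inner_add_right)
      qed
      then have "d \<bullet> (y + t *\<^sub>R z) \<le> M"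
        by (intro bounded) blast
      moreover have "t * (d \<bullet> z) = \<bar>M - d \<bullet> y\<bar> + 1"
        using dz by (simp add: t_def)
      ultimately show False
        by (simp add: inner_add_right)
    qed
    \<comment> \<open>Ratio test: \<open>r i\<close> is the step length at which constraint
      \<open>i\<close> becomes tight, so the minimum over \<open>J\<close> is the longest feasible
      step.\<close>
    define r where "r i = (b i - a i \<bullet> y) / (a i \<bullet> z)" for i
    define t where "t = Min (r ` J)"
    have "t \<in> r ` J"
      using \<open>finite J\<close> \<open>J \<noteq> {}\<close> by (simp add: t_def)
    then obtain j where j: "j \<in> J" "t = r j"
      by blast
    have t_le: "t \<le> r i" if "i \<in> J" for i
      using \<open>finite J\<close> that by (simp add: t_def)
    have "t \<ge> 0"
      using j less.prems by (auto simp: J_def r_def)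
    define y' where "y' = y + t *\<^sub>R z"
    have feas: "\<forall>i\<in>I. a i \<bullet> y' \<le> b i"
    proof
      fix i assume "i \<in> I"
      show "a i \<bullet> y' \<le> b i"
      proof (cases "i \<in> J")
        case True
        then show ?thesis
          using t_le[OF True] by (simp add: y'_def r_def J_def inner_add_right field_simps)
      next
        case False
        then have "t * (a i \<bullet> z) \<le> 0"
          using \<open>i \<in> I\<close> \<open>t \<ge> 0\<close> by (auto simp: J_def not_less intro: mult_nonneg_nonpos)
        then show ?thesis
          using less.prems \<open>i \<in> I\<close> by (force simp: y'_def inner_add_right)
      qed
    qed
    \<comment> \<open>Tight constraints stay tight because they are orthogonal to \<open>z\<close>.
      The blocking constraint \<open>j\<close> is newly tight: it grows along \<open>z\<close>, so
      it was slack at \<open>y\<close>.\<close>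
    have "a i \<bullet> y \<noteq> b i" if "i \<in> I" "a i \<bullet> y' \<noteq> b i" for i
      using az that by (auto simp: y'_def inner_add_right)
    moreover have "j \<in> I" "a j \<bullet> y \<noteq> b j" "a j \<bullet> y' = b j"
      using j az by (auto simp: J_def y'_def r_def inner_add_right)
    ultimately have "{i\<in>I. a i \<bullet> y' \<noteq> b i} \<subset> {i\<in>I. a i \<bullet> y \<noteq> b i}"
      by blast
    then have "card {i\<in>I. a i \<bullet> y' \<noteq> b i} < card {i\<in>I. a i \<bullet> y \<noteq> b i}"
      using assms(1) by (intro psubset_card_mono) auto
    from less.hyps[OF this feas] obtain y'' where "\<forall>i\<in>I. a i \<bullet> y'' \<le> b i"
      "d \<bullet> y' \<le> d \<bullet> y''" "d \<in> span (a ` ?T y'')"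
      by blast
    moreover have "d \<bullet> y \<le> d \<bullet> y'"
      using dz \<open>t \<ge> 0\<close> by (simp add: y'_def inner_add_right)
    ultimately show ?thesis
      by (meson order_trans)
  qed
qed

text \<open>The polyhedron may be unbounded and have no vertices, so neither compactness nor extreme
  points are used. The points of \<open>V\<close> dominate all feasible ones and yield only finitely
  many values.\<close>

lemma linear_program_attains_max:
  fixes a :: "'i \<Rightarrow> 'v::euclidean_space" and b :: "'i \<Rightarrow> real"
  assumes "finite I"
    and bounded: "\<And>y. \<forall>i\<in>I. a i \<bullet> y \<le> b i \<Longrightarrow> d \<bullet> y \<le> M"
    and feasible: "\<forall>i\<in>I. a i \<bullet> y0 \<le> b i"
  obtains y where "\<forall>i\<in>I. a i \<bullet> y \<le> b i"
    and "\<And>y'. \<forall>i\<in>I. a i \<bullet> y' \<le> b i \<Longrightarrow> d \<bullet> y' \<le> d \<bullet> y"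
proof -
  define P where "P y \<longleftrightarrow> (\<forall>i\<in>I. a i \<bullet> y \<le> b i)" for y
  define T where "T y = {i\<in>I. a i \<bullet> y = b i}" for y
  define V where "V = {y. P y \<and> d \<in> span (a ` T y)}"
  have tight: "\<exists>y'\<in>V. d \<bullet> y \<le> d \<bullet> y'" if "P y" for y
    using linear_program_tight_point[OF assms(1) bounded, where y = y] that
    unfolding P_def V_def T_def by blast
  have same: "d \<bullet> y = d \<bullet> y'" if "y \<in> V" "T y = T y'" for y y'
  proof -
    \<comment> \<open>Both points satisfy the same equations, so their difference is orthogonal to
      each tight row, hence to \<open>d\<close> in their span.\<close>
    have "orthogonal (y - y') (a i)" if "i \<in> T y" for i
    proof -
      have "i \<in> T y'"
        using that \<open>T y = T y'\<close> by simp
      with \<open>i \<in> T y\<close> show ?thesis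
        by (simp add: T_def orthogonal_def inner_diff_left inner_diff_right inner_commute)
    qed
    then have "orthogonal (y - y') d"
      using that(1) by (intro orthogonal_to_span[of d "a ` T y"]) (auto simp: V_def)
    then show ?thesis
      by (simp add: orthogonal_def inner_diff_right inner_commute[of _ d])
  qed
  have "finite (T ` V)"
    by (rule finite_subset[of _ "Pow I"]) (use assms(1) in \<open>auto simp: T_def\<close>)
  moreover have "(\<bullet>) d ` V = (\<lambda>S. d \<bullet> (SOME y. y \<in> V \<and> T y = S)) ` T ` V"
  proof -
    have "d \<bullet> y = d \<bullet> (SOME y'. y' \<in> V \<and> T y' = T y)" if "y \<in> V" for y
      using someI[of "\<lambda>y'. y' \<in> V \<and> T y' = T y" y] that by (intro same) auto
    then show ?thesis
      by (auto simp: image_image intro!: image_cong)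
  qed
  ultimately have fin: "finite ((\<bullet>) d ` V)"
    by simp
  have "V \<noteq> {}"
    using tight[of y0] feasible by (auto simp: P_def)
  then have "Max ((\<bullet>) d ` V) \<in> (\<bullet>) d ` V"
    using fin by (intro Max_in) auto
  then obtain y where y: "y \<in> V" "d \<bullet> y = Max ((\<bullet>) d ` V)"
    by force
  have "d \<bullet> y' \<le> d \<bullet> y" if "P y'" for y'
    using tight[OF that] y(2) Max_ge[OF fin] by fastforce
  with y(1) show thesis
    by (intro that[of y]) (auto simp: V_def P_def)
qed

section \<open>Attainment of the lower-level maximum\<close>

lemma finite_binary_vectors: "finite (binary_vectors :: (real ^ 'n) set)"
proof (rule finite_surj)
  show "finite (UNIV :: 'n set set)"
    by simp
  show "binary_vectors \<subseteq> range (\<lambda>S :: 'n set. (\<chi> i. of_bool (i \<in> S)) :: real ^ 'n)"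
  proof
    fix v :: "real ^ 'n" assume "v \<in> binary_vectors"
    then have "v = (\<chi> i. of_bool (i \<in> {i. v $ i = 1}))"
      by (auto simp: binary_vectors_def vec_eq_iff)
    then show "v \<in> range (\<lambda>S :: 'n set. (\<chi> i. of_bool (i \<in> S)))"
      by blast
  qed
qed

text \<open>Fixing the binary part leaves a linear program in \<open>y2\<close>; the best of the
  finitely many optima is the maximum.\<close>

lemma lower_values_attains_max:
  fixes A :: "real ^ 'nx ^ 'm" and B1 :: "real ^ 'n1 ^ 'm" and B2 :: "real ^ 'n2 ^ 'm"
  assumes "lower_feasible A B1 B2 h x \<noteq> {}"
    and "bdd_above (lower_values A B1 B2 h d1 d2 x)"
  obtains m where "m \<in> lower_values A B1 B2 h d1 d2 x"
    and "\<And>v. v \<in> lower_values A B1 B2 h d1 d2 x \<Longrightarrow> v \<le> m"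
proof -
  define F where "F y1 = {y2. (y1, y2) \<in> lower_feasible A B1 B2 h x}" for y1
  \<comment> \<open>With \<open>y1\<close> moved to the right-hand side, the constraint normals are
    the rows of \<open>B2\<close>.\<close>
  have F_iff: "y2 \<in> F y1 \<longleftrightarrow> y1 \<in> binary_vectors \<and>
      (\<forall>i\<in>UNIV. B2 $ i \<bullet> y2 \<le> (h - A *v x - B1 *v y1) $ i)" for y1 y2
    by (simp add: F_def lower_feasible_def less_eq_vec_def
        matrix_vector_mul_component algebra_simps)
  have values_eq: "lower_values A B1 B2 h d1 d2 x = (\<Union>y1. (\<lambda>y2. d1 \<bullet> y1 + d2 \<bullet> y2) ` F y1)"
    by (force simp: lower_values_def F_def)
  obtain M where M: "d1 \<bullet> y1 + d2 \<bullet> y2 \<le> M" if "y2 \<in> F y1" for y1 y2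
    using assms(2) unfolding values_eq bdd_above_def by blast
  define Y where "Y = {y1. F y1 \<noteq> {}}"
  have "\<exists>y2\<in>F y1. \<forall>y2'\<in>F y1. d2 \<bullet> y2' \<le> d2 \<bullet> y2" if "y1 \<in> Y" for y1
  proof -
    from that obtain y0 where y0: "y0 \<in> F y1"
      by (auto simp: Y_def)
    then have bin: "y1 \<in> binary_vectors"
      by (simp add: F_iff)
    have F_eq: "y2 \<in> F y1 \<longleftrightarrow> (\<forall>i\<in>UNIV. B2 $ i \<bullet> y2 \<le> (h - A *v x - B1 *v y1) $ i)" for y2
      using bin by (simp add: F_iff)
    have bound: "d2 \<bullet> y2 \<le> M - d1 \<bullet> y1"
      if "\<forall>i\<in>UNIV. B2 $ i \<bullet> y2 \<le> (h - A *v x - B1 *v y1) $ i" for y2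
      using M[of y2 y1] that by (simp add: F_eq)
    show ?thesis
    proof (rule linear_program_attains_max[OF finite, where d = d2])
      show "\<forall>i\<in>UNIV. B2 $ i \<bullet> y0 \<le> (h - A *v x - B1 *v y1) $ i"
        using y0 by (simp only: F_eq)
    qed (blast intro: bound F_eq[THEN iffD2] dest: F_eq[THEN iffD1])+
  qed
  then obtain g where g: "\<And>y1. y1 \<in> Y \<Longrightarrow> g y1 \<in> F y1"
    "\<And>y1 y2. y1 \<in> Y \<Longrightarrow> y2 \<in> F y1 \<Longrightarrow> d2 \<bullet> y2 \<le> d2 \<bullet> g y1"
    by metis
  define c where "c y1 = d1 \<bullet> y1 + d2 \<bullet> g y1" for y1
  have "finite Y"
    by (rule finite_subset[OF _ finite_binary_vectors]) (auto simp: Y_def F_iff)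
  then have fin: "finite (c ` Y)"
    by simp
  have "Y \<noteq> {}"
    using assms(1) by (auto simp: Y_def F_def)
  then have "Max (c ` Y) \<in> c ` Y"
    using fin by (intro Max_in) auto
  then obtain y1 where y1: "y1 \<in> Y" "c y1 = Max (c ` Y)"
    by force
  show thesis
  proof (rule that[of "c y1"])
    show "c y1 \<in> lower_values A B1 B2 h d1 d2 x"
      using g(1)[OF y1(1)] by (auto simp: values_eq c_def)
    fix v assume "v \<in> lower_values A B1 B2 h d1 d2 x"
    then obtain z1 z2 where z: "z2 \<in> F z1" "v = d1 \<bullet> z1 + d2 \<bullet> z2"
      by (auto simp: values_eq)
    then have "z1 \<in> Y"
      by (auto simp: Y_def)
    then have "v \<le> c z1"
      using g(2) z by (simp add: c_def)
    also have "\<dots> \<le> c y1"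
      using \<open>z1 \<in> Y\<close> fin y1(2) by simp
    finally show "v \<le> c y1" .
  qed
qed

text \<open>\<open>GREATEST\<close> is informative only once a maximum is known to exist, which is
  where attainment enters.\<close>

lemma lower_value_le_phi:
  assumes "lower_feasible A B1 B2 h x \<noteq> {}"
    and "bdd_above (lower_values A B1 B2 h d1 d2 x)"
    and "v \<in> lower_values A B1 B2 h d1 d2 x"
  shows "v \<le> phi A B1 B2 h d1 d2 x"
proof -
  obtain m where "m \<in> lower_values A B1 B2 h d1 d2 x"
    and m: "\<And>v. v \<in> lower_values A B1 B2 h d1 d2 x \<Longrightarrow> v \<le> m"
    using lower_values_attains_max[OF assms(1,2)] by blast
  then have "phi A B1 B2 h d1 d2 x = m"
    unfolding phi_def by (intro Greatest_equality)
  then show ?thesis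
    using m[OF assms(3)] by simp
qed

section \<open>Bounds over binary vectors and the affine decision rule\<close>

text \<open>Each term on the right is \<open>0\<close> or \<open>v $ i\<close>, and the minimum of
  these is the entry of \<open>vec_neg v\<close>.\<close>

lemma inner_one_vec_neg_le:
  fixes v x :: "real ^ 'n"
  assumes "x \<in> binary_vectors"
  shows "1 \<bullet> vec_neg v \<le> v \<bullet> x"
  unfolding inner_vec_def
proof (rule sum_mono)
  fix i
  have "x $ i = 0 \<or> x $ i = 1"
    using assms by (auto simp: binary_vectors_def)
  then show "1 $ i \<bullet> vec_neg v $ i \<le> v $ i \<bullet> x $ i"
    by (auto simp: vec_neg_def)
qed

lemma matrix_vector_mult_le_mat_pos:
  fixes M :: "real ^ 'n ^ 'm"
  assumes "x \<in> binary_vectors"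
  shows "M *v x \<le> mat_pos M *v 1"
  unfolding less_eq_vec_def matrix_vector_mult_def vec_lambda_beta
proof (intro allI sum_mono)
  fix i j
  have "x $ j = 0 \<or> x $ j = 1"
    using assms by (auto simp: binary_vectors_def)
  then show "M $ i $ j * x $ j \<le> mat_pos M $ i $ j * 1 $ j"
    by (auto simp: mat_pos_def vec_pos_def)
qed

lemma Omega_minorizes_phi:
  fixes A :: "real ^ 'nx ^ 'm" and B1 :: "real ^ 'n1 ^ 'm" and B2 :: "real ^ 'n2 ^ 'm"
  assumes x: "x \<in> binary_vectors"
    and "lower_feasible A B1 B2 h x \<noteq> {}"
    and "bdd_above (lower_values A B1 B2 h d1 d2 x)"
    and "(\<alpha>, \<beta>) \<in> Omega A B1 B2 h d1 d2"
  shows "\<alpha> \<bullet> x + \<beta> \<le> phi A B1 B2 h d1 d2 x"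
proof -
  obtain y1 y2 and U :: "real ^ 'nx ^ 'n2" where y1: "y1 \<in> binary_vectors"
    and \<beta>: "\<beta> \<le> d1 \<bullet> y1 + d2 \<bullet> y2 + 1 \<bullet> vec_neg (transpose U *v d2 - \<alpha>)"
    and feas: "B1 *v y1 + B2 *v y2 \<le> h - mat_pos (A + B2 ** U) *v 1"
    using assms(4) unfolding Omega_def by blast
  have "B1 *v y1 + B2 *v y2 \<le> h - (A + B2 ** U) *v x"
    using feas matrix_vector_mult_le_mat_pos[OF x] by (meson diff_left_mono order_trans)
  \<comment> \<open>Moving \<open>B2 *v (U *v x)\<close> to the left absorbs it into the continuous
    variable.\<close>
  then have "B1 *v y1 + B2 *v (y2 + U *v x) \<le> h - A *v x"
    by (simp add: matrix_vector_mult_add_rdistrib matrix_vector_right_distrib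
        matrix_vector_mul_assoc algebra_simps)
  then have "d1 \<bullet> y1 + d2 \<bullet> (y2 + U *v x) \<in> lower_values A B1 B2 h d1 d2 x"
    using y1 unfolding lower_values_def lower_feasible_def by force
  then have "d1 \<bullet> y1 + d2 \<bullet> (y2 + U *v x) \<le> phi A B1 B2 h d1 d2 x"
    by (rule lower_value_le_phi[OF assms(2,3)])
  \<comment> \<open>The transpose is moved across the inner product:
    \<open>(transpose U *v d2) \<bullet> x\<close> equals
    \<open>d2 \<bullet> (U *v x)\<close>.\<close>
  moreover have "1 \<bullet> vec_neg (transpose U *v d2 - \<alpha>) \<le> d2 \<bullet> (U *v x) - \<alpha> \<bullet> x"
    using inner_one_vec_neg_le[OF x, of "transpose U *v d2 - \<alpha>"]
    by (simp add: inner_diff_left dot_lmul_matrix)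
  ultimately show ?thesis
    using \<beta> by (simp add: inner_add_right)
qed

theorem proposition12:
  fixes A :: "real ^ 'nx ^ 'm"
    and B1 :: "real ^ 'n1 ^ 'm"
    and B2 :: "real ^ 'n2 ^ 'm"
    and h :: "real ^ 'm"
    and d1 :: "real ^ 'n1"
    and d2 :: "real ^ 'n2"
    and \<alpha> :: "real ^ 'nx"
    and \<beta> :: real
  assumes feasible: "\<And>x. x \<in> binary_vectors \<Longrightarrow> lower_feasible A B1 B2 h x \<noteq> {}"
    and bounded: "\<And>x. x \<in> binary_vectors \<Longrightarrow> bdd_above (lower_values A B1 B2 h d1 d2 x)"
    and "(\<alpha>, \<beta>) \<in> Omega A B1 B2 h d1 d2"
  shows "(\<forall>x \<in> binary_vectors. \<forall>y1 \<in> binary_vectors. \<forall>y2.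
            d1 \<bullet> y1 + d2 \<bullet> y2 \<ge> phi A B1 B2 h d1 d2 x \<longrightarrow>
            d1 \<bullet> y1 + d2 \<bullet> y2 \<ge> \<alpha> \<bullet> x + \<beta>)
       \<and> (\<forall>x \<in> binary_vectors. \<alpha> \<bullet> x + \<beta> \<le> phi A B1 B2 h d1 d2 x)"
proof -
  have "\<alpha> \<bullet> x + \<beta> \<le> phi A B1 B2 h d1 d2 x" if "x \<in> binary_vectors" for x
    using that by (intro Omega_minorizes_phi feasible bounded assms(3))
  then show ?thesis
    by (blast intro: order_trans)
qed

end
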